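(* For any $\delta\in[0,1)$, the optimal $\mathrm{CVaR}_\delta$-competitive ratio for continuous-time ski rental satisfies $$\alpha_\delta^*\ge\max\left\{\frac{e}{e-1},\;2-\frac{1}{2^{\lfloor\frac{1}{1-\delta}\rfloor-1}}\right\}.$$
   Context: Conditional value-at-risk (loss convention): for a real random variable $Y$ and $\delta\in[0,1)$, $\mathrm{CVaR}_\delta[Y]=\inf_{t\in\mathbb{R}}\{t+\frac{1}{1-\delta}\mathbb{E}[(Y-t)^+]\}=\frac{1}{1-\delta}\int_\delta^1F_Y^{-1}(p)\,dp$. Continuous-time ski rental (buying cost normalized to $1$): a strategy is a probability distribution $\mu$ on $\mathbb{R}_+$ of the purchase time $X$; for adversary season length $s>0$ the cost is $C(X,s)=s\cdot\mathbb{1}_{X>s}+(X+1)\cdot\mathbb{1}_{X\le s}$. Define $\alpha_\delta^{\mu}(s)=\mathrm{CVaR}_\delta[C(X,s)]/\min\{s,1\}$, $\alpha_\delta^\mu=\sup_{s>0}\alpha_\delta^\mu(s)$, and $\alpha_\delta^*=\inf_\mu\alpha_\delta^\mu$. *)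

theory Defs
  imports "HOL-Probability.Probability"
begin

text \<open>
  The conditional value-at-risk is extended-real-valued because no integrability of \<open>Y\<close> is
  assumed; the expectation of the nonnegative variable \<open>(Y - t)\<^sup>+\<close> is a Lebesgue integral in
  \<open>[0, \<infinity>]\<close>.
\<close>
definition CVaR :: "real \<Rightarrow> 'a measure \<Rightarrow> ('a \<Rightarrow> real) \<Rightarrow> ereal" where
  "CVaR \<delta> M Y =
     (INF t::real. ereal t +
        ereal (1 / (1 - \<delta>)) * enn2ereal (\<integral>\<^sup>+ x. ennreal (max 0 (Y x - t)) \<partial>M))"

text \<open>Distributions on \<open>\<real>\<^sub>+ = [0, \<infinity>)\<close>, represented as Borel measures on the whole real line.\<close>
definition strategies :: "real measure set" where
  "strategies = {\<mu>. prob_space \<mu> \<and> sets \<mu> = sets borel \<and> (AE x in \<mu>. 0 \<le> x)}"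

definition ski_cost :: "real \<Rightarrow> real \<Rightarrow> real" where
  "ski_cost x s = s * of_bool (x > s) + (x + 1) * of_bool (x \<le> s)"

definition comp_ratio_at :: "real \<Rightarrow> real measure \<Rightarrow> real \<Rightarrow> ereal" where
  "comp_ratio_at \<delta> \<mu> s = CVaR \<delta> \<mu> (\<lambda>x. ski_cost x s) / ereal (min s 1)"

text \<open>
  The supremum may be infinite, for instance when \<open>\<mu>\<close> has an atom at \<open>0\<close>.
\<close>
definition comp_ratio :: "real \<Rightarrow> real measure \<Rightarrow> ereal" where
  "comp_ratio \<delta> \<mu> = (SUP s\<in>{0<..}. comp_ratio_at \<delta> \<mu> s)"

definition opt_comp_ratio :: "real \<Rightarrow> ereal" where
  "opt_comp_ratio \<delta> = (INF \<mu>\<in>strategies. comp_ratio \<delta> \<mu>)"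

end

theory Submission
  imports Defs
begin

text \<open>
  Since CVaR dominates the expectation, the bound \<open>e / (e - 1)\<close> follows from Yao's principle with
  an exponentially distributed season length: against it every purchase time costs exactly \<open>1\<close> on
  average, whereas the offline optimum \<open>min s 1\<close> averages to \<open>1 - 1 / e\<close>.

  For the other bound let \<open>n = \<lfloor>1 / (1 - \<delta>)\<rfloor>\<close> and \<open>a k = 1 - 1 / 2 ^ k\<close>. If the ratio is below \<open>2\<close>,
  then no interval \<open>[a k, a (k + 1))\<close> has mass above \<open>1 / n \<ge> 1 - \<delta>\<close>: otherwise the season length
  \<open>s = a (k + 1)\<close> would give CVaR at least \<open>1 + a k = 2 * s\<close>. Hence mass at least \<open>1 / n\<close> lies on
  \<open>[a (n - 1), \<infinity>)\<close>, and the season length \<open>s = 2\<close> yields the ratio \<open>1 + a (n - 1)\<close>.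
\<close>

text \<open>For \<open>t < c\<close> the expected excess over \<open>t\<close> is at least
  \<open>(c - t) * (1 - \<delta>)\<close>, which the factor \<open>1 / (1 - \<delta>)\<close> turns
  back into \<open>c - t\<close>; for \<open>t \<ge> c\<close> the summand \<open>t\<close> alone
  suffices.\<close>

lemma CVaR_ge_of_prob:
  assumes "prob_space M" and "A \<in> sets M" and "\<delta> < 1"
    and prob: "1 - \<delta> \<le> measure M A"
    and lb: "\<And>x. x \<in> A \<Longrightarrow> c \<le> Y x"
  shows "ereal c \<le> CVaR \<delta> M Y"
  unfolding CVaR_def
proof (rule INF_greatest)
  fix t :: real
  interpret prob_space M by fact
  let ?I = "\<integral>\<^sup>+ x. ennreal (max 0 (Y x - t)) \<partial>M"
  show "ereal c \<le> ereal t + ereal (1 / (1 - \<delta>)) * enn2ereal ?I"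
  proof (cases "c \<le> t")
    case True
    then have "ereal c \<le> ereal t + 0" by simp
    also have "\<dots> \<le> ereal t + ereal (1 / (1 - \<delta>)) * enn2ereal ?I"
      using assms(3) by (intro add_left_mono ereal_0_le_mult) auto
    finally show ?thesis .
  next
    case False
    have "ennreal ((c - t) * (1 - \<delta>)) \<le> ennreal ((c - t) * measure M A)"
      using False prob by (intro ennreal_leI mult_left_mono) auto
    also have "\<dots> = (\<integral>\<^sup>+ x. ennreal (c - t) * indicator A x \<partial>M)"
      using assms(2) False by (simp add: nn_integral_cmult_indicator emeasure_eq_measure ennreal_mult)
    also have "\<dots> \<le> ?I"
      by (intro nn_integral_mono) (auto simp: indicator_def lb intro!: ennreal_leI max.coboundedI2)
    finally have "enn2ereal (ennreal ((c - t) * (1 - \<delta>))) \<le> enn2ereal ?I"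
      by (simp add: less_eq_ennreal.rep_eq)
    then have *: "ereal ((c - t) * (1 - \<delta>)) \<le> enn2ereal ?I"
      using False assms(3) by (simp add: enn2ereal_ennreal)
    have "ereal c = ereal t + ereal (1 / (1 - \<delta>)) * ereal ((c - t) * (1 - \<delta>))"
      using assms(3) by simp
    also have "\<dots> \<le> ereal t + ereal (1 / (1 - \<delta>)) * enn2ereal ?I"
      using assms(3) * by (intro add_left_mono ereal_mult_left_mono) auto
    finally show ?thesis .
  qed
qed

text \<open>The factor \<open>1 / (1 - \<delta>)\<close> is at least \<open>1\<close>, and
  \<open>t + max 0 (Y x - t)\<close> dominates \<open>Y x\<close> for every threshold
  \<open>t\<close>.\<close>

lemma nn_integral_le_CVaR:
  assumes "prob_space M" and [measurable]: "Y \<in> borel_measurable M"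
    and nonneg: "AE x in M. 0 \<le> Y x" and "0 \<le> \<delta>" "\<delta> < 1"
  shows "enn2ereal (\<integral>\<^sup>+ x. ennreal (Y x) \<partial>M) \<le> CVaR \<delta> M Y"
  unfolding CVaR_def
proof (rule INF_greatest)
  fix t :: real
  interpret prob_space M by fact
  let ?E = "\<integral>\<^sup>+ x. ennreal (Y x) \<partial>M"
  let ?I = "\<integral>\<^sup>+ x. ennreal (max 0 (Y x - t)) \<partial>M"
  have scale: "enn2ereal ?I \<le> ereal (1 / (1 - \<delta>)) * enn2ereal ?I"
    using ereal_mult_right_mono[of 1 "ereal (1 / (1 - \<delta>))" "enn2ereal ?I"] assms by simp
  have "enn2ereal ?E \<le> ereal t + enn2ereal ?I"
  proof (cases "0 \<le> t")
    case True
    have "?E \<le> (\<integral>\<^sup>+ x. ennreal t + ennreal (max 0 (Y x - t)) \<partial>M)"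
      using True by (intro nn_integral_mono, subst ennreal_plus[symmetric]) (auto intro!: ennreal_leI simp del: ennreal_plus)
    also have "\<dots> = ennreal t + ?I"
      by (subst nn_integral_add) (auto simp: emeasure_space_1)
    finally have "enn2ereal ?E \<le> enn2ereal (ennreal t + ?I)"
      by (simp add: less_eq_ennreal.rep_eq)
    then show ?thesis using True by (simp add: plus_ennreal.rep_eq enn2ereal_ennreal)
  next
    case False
    \<comment> \<open>For negative \<open>t\<close> the positive part is inactive, so
      \<open>?I\<close> exceeds \<open>?E\<close> by exactly \<open>- t\<close>. The shift is
      written as an addition because \<open>ennreal\<close> has no negative values.\<close>
    have "?E + ennreal (- t) = (\<integral>\<^sup>+ x. ennreal (Y x) + ennreal (- t) \<partial>M)"
      by (subst nn_integral_add) (auto simp: emeasure_space_1)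
    also have "\<dots> = ?I"
      using nonneg False by (intro nn_integral_cong_AE)
        (auto elim!: eventually_mono simp: ennreal_plus[symmetric] simp del: ennreal_plus)
    finally have "enn2ereal ?I = enn2ereal (?E + ennreal (- t))" by (rule arg_cong[OF sym])
    then have "enn2ereal ?I = enn2ereal ?E + ereal (- t)"
      using False by (simp only: plus_ennreal.rep_eq) (simp add: enn2ereal_ennreal)
    then show ?thesis by (cases "enn2ereal ?E") auto
  qed
  also have "\<dots> \<le> ereal t + ereal (1 / (1 - \<delta>)) * enn2ereal ?I"
    by (intro add_left_mono scale)
  finally show "enn2ereal ?E \<le> ereal t + ereal (1 / (1 - \<delta>)) * enn2ereal ?I" .
qed

text \<open>Used twice: \<open>c = x + 1\<close> gives \<open>1\<close> for every purchase time
  \<open>x\<close>, the equalizing property of the exponential season length;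
  \<open>x = c = 1\<close> gives \<open>1 - exp (- 1)\<close>, the average offline optimum.\<close>

lemma nn_integral_exp_truncated:
  fixes x c :: real
  assumes "0 \<le> x" "0 \<le> c"
  shows "(\<integral>\<^sup>+ s. ennreal (exp (- s) * (if s < x then s else c)) * indicator {0<..} s \<partial>lborel)
    = ennreal (1 + (c - x - 1) * exp (- x))"
proof -
  have left: "(\<integral>\<^sup>+ s. ennreal (exp (- s) * s) * indicator {0..x} s \<partial>lborel)
      = ennreal (- (x + 1) * exp (- x) - - (0 + 1) * exp (- 0))"
    using assms(1) by (intro nn_integral_FTC_Icc)
      (auto intro!: derivative_eq_intros simp: has_real_derivative_iff_has_vector_derivative[symmetric] algebra_simps)
  have "((\<lambda>s. - c * exp (- s)) \<longlongrightarrow> 0) at_top"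
    by real_asymp
  then have right: "(\<integral>\<^sup>+ s. ennreal (exp (- s) * c) * indicator {x..} s \<partial>lborel)
      = ennreal (0 - - c * exp (- x))"
    using assms by (intro nn_integral_FTC_atLeast) (auto intro!: derivative_eq_intros)
  \<comment> \<open>The closed ranges overlap at \<open>x\<close> and include \<open>0\<close>; both
    points are null sets.\<close>
  have "(\<integral>\<^sup>+ s. ennreal (exp (- s) * (if s < x then s else c)) * indicator {0<..} s \<partial>lborel)
      = (\<integral>\<^sup>+ s. ennreal (exp (- s) * s) * indicator {0..x} s
          + ennreal (exp (- s) * c) * indicator {x..} s \<partial>lborel)"
    using AE_lborel_singleton[of x] AE_lborel_singleton[of 0] assms
    by (intro nn_integral_cong_AE) (auto simp: indicator_def elim!: eventually_elim2)
  also have "\<dots> = ennreal (1 - (x + 1) * exp (- x)) + ennreal (c * exp (- x))"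
    by (subst nn_integral_add) (use left right in \<open>auto simp: algebra_simps\<close>)
  also have "\<dots> = ennreal (1 + (c - x - 1) * exp (- x))"
  proof -
    have "(x + 1) * exp (- x) \<le> 1"
      using exp_ge_add_one_self[of x] by (simp add: exp_minus field_simps)
    then show ?thesis
      using assms by (simp add: ennreal_plus[symmetric] algebra_simps del: ennreal_plus)
  qed
  finally show ?thesis .
qed

lemma ski_cost_alt: "ski_cost x s = (if s < x then s else x + 1)"
  by (simp add: ski_cost_def)

lemma strategiesD:
  assumes "\<mu> \<in> strategies"
  shows "prob_space \<mu>" "sets \<mu> = sets borel" "AE x in \<mu>. 0 \<le> x"
  using assms by (auto simp: strategies_def)

lemma comp_ratio_ge_of_CVaR:
  assumes "0 < s" "ereal (r * min s 1) \<le> CVaR \<delta> \<mu> (\<lambda>x. ski_cost x s)"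
  shows "ereal r \<le> comp_ratio \<delta> \<mu>"
proof -
  define m where "m = min s 1"
  have "0 < m" using assms(1) by (simp add: m_def)
  then have "ereal r \<le> comp_ratio_at \<delta> \<mu> s"
    unfolding comp_ratio_at_def m_def[symmetric] using assms(2)[folded m_def]
    by (subst ereal_le_divide_pos) (auto simp: mult.commute)
  also have "\<dots> \<le> comp_ratio \<delta> \<mu>"
    unfolding comp_ratio_def using assms(1) by (intro SUP_upper) auto
  finally show ?thesis .
qed

lemma comp_ratio_ge_exp_bound:
  assumes \<mu>: "\<mu> \<in> strategies" and "0 \<le> \<delta>" "\<delta> < 1"
  shows "ereal (exp 1 / (exp 1 - 1)) \<le> comp_ratio \<delta> \<mu>"
proof (rule ccontr)
  note [measurable_cong] = strategiesD(2)[OF \<mu>]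
  note ge0 = strategiesD(3)[OF \<mu>]
  interpret prob_space \<mu> using strategiesD(1)[OF \<mu>] .
  interpret pair_sigma_finite \<mu> lborel ..
  assume "\<not> ereal (exp 1 / (exp 1 - 1)) \<le> comp_ratio \<delta> \<mu>"
  \<comment> \<open>The ratio is an extended real; a real \<open>r\<close> strictly between it and
    the bound can serve as a multiplier in the \<open>ennreal\<close> integrals.\<close>
  then obtain r where r: "comp_ratio \<delta> \<mu> < ereal r" "r < exp 1 / (exp 1 - 1)"
    using ereal_dense2[of "comp_ratio \<delta> \<mu>" "ereal (exp 1 / (exp 1 - 1))"]
    by (auto simp: not_le simp del: ereal_less_eq)
  have E: "(\<integral>\<^sup>+ x. ennreal (ski_cost x s) \<partial>\<mu>) \<le> ennreal (r * min s 1)" if "0 < s" for s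
  proof (rule ccontr)
    assume "\<not> ?thesis"
    then have "ennreal (r * min s 1) \<le> (\<integral>\<^sup>+ x. ennreal (ski_cost x s) \<partial>\<mu>)" by simp
    then have "ereal (r * min s 1) \<le> enn2ereal (\<integral>\<^sup>+ x. ennreal (ski_cost x s) \<partial>\<mu>)"
      using enn2ereal_nonneg[of "\<integral>\<^sup>+ x. ennreal (ski_cost x s) \<partial>\<mu>"]
      by (simp add: less_eq_ennreal.rep_eq ennreal.rep_eq)
    also have "\<dots> \<le> CVaR \<delta> \<mu> (\<lambda>x. ski_cost x s)"
      using ge0 that assms by (intro nn_integral_le_CVaR)
        (auto simp: ski_cost_alt prob_space_axioms elim!: eventually_mono)
    finally show False
      using comp_ratio_ge_of_CVaR[OF that] r(1) by (simp add: leD)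
  qed
  \<comment> \<open>\<open>ennreal\<close> sends negative numbers to \<open>0\<close>, so the sign
    of \<open>r\<close> is settled before it is factored out. For negative \<open>r\<close>, the
    bound \<open>E\<close> at season length \<open>1\<close> would make a cost of at least
    \<open>1\<close> vanish almost surely.\<close>
  have r0: "0 \<le> r"
  proof (rule ccontr)
    assume "\<not> 0 \<le> r"
    then have "(\<integral>\<^sup>+ x. ennreal (ski_cost x 1) \<partial>\<mu>) = 0"
      using E[of 1] by (simp add: ennreal_neg)
    then have "AE x in \<mu>. ski_cost x 1 \<le> 0"
      by (subst (asm) nn_integral_0_iff_AE) (auto simp: ski_cost_alt ennreal_eq_0_iff)
    with ge0 have "AE x in \<mu>. False"
      by eventually_elim (auto simp: ski_cost_alt split: if_splits)
    then show False by simp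
  qed
  \<comment> \<open>Each purchase time costs \<open>1\<close> on average over \<open>s\<close>;
    exchanging the integrals then lets \<open>E\<close> act at each fixed season length.\<close>
  have "1 = (\<integral>\<^sup>+ x. 1 \<partial>\<mu>)"
    by (simp add: emeasure_space_1)
  also have "\<dots> = (\<integral>\<^sup>+ x. (\<integral>\<^sup>+ s. ennreal (exp (- s) * ski_cost x s) * indicator {0<..} s \<partial>lborel) \<partial>\<mu>)"
    using ge0 by (intro nn_integral_cong_AE)
      (auto elim!: eventually_mono simp: ski_cost_alt nn_integral_exp_truncated)
  also have "\<dots> = (\<integral>\<^sup>+ s. (\<integral>\<^sup>+ x. ennreal (exp (- s) * ski_cost x s) * indicator {0<..} s \<partial>\<mu>) \<partial>lborel)"
    by (intro Fubini'[symmetric]) (simp add: ski_cost_alt)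
  also have "\<dots> = (\<integral>\<^sup>+ s. ennreal (exp (- s)) * (\<integral>\<^sup>+ x. ennreal (ski_cost x s) \<partial>\<mu>) * indicator {0<..} s \<partial>lborel)"
    by (intro nn_integral_cong)
      (simp add: ski_cost_alt ennreal_mult' nn_integral_cmult nn_integral_multc)
  also have "\<dots> \<le> (\<integral>\<^sup>+ s. ennreal r * (ennreal (exp (- s) * (if s < 1 then s else 1)) * indicator {0<..} s) \<partial>lborel)"
  proof (intro nn_integral_mono)
    fix s :: real
    show "ennreal (exp (- s)) * (\<integral>\<^sup>+ x. ennreal (ski_cost x s) \<partial>\<mu>) * indicator {0<..} s
      \<le> ennreal r * (ennreal (exp (- s) * (if s < 1 then s else 1)) * indicator {0<..} s)"
    proof (cases "0 < s")
      case True
      have "ennreal (exp (- s)) * (\<integral>\<^sup>+ x. ennreal (ski_cost x s) \<partial>\<mu>)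
          \<le> ennreal (exp (- s)) * ennreal (r * min s 1)"
        using E[OF True] by (rule mult_left_mono) simp
      also have "\<dots> = ennreal r * ennreal (exp (- s) * (if s < 1 then s else 1))"
        using True r0 by (simp add: ennreal_mult'[symmetric] min_def mult_ac)
      finally show ?thesis using True by simp
    qed simp
  qed
  also have "\<dots> = ennreal (r * (1 - exp (- 1)))"
    using r0 by (subst nn_integral_cmult) (auto simp: nn_integral_exp_truncated ennreal_mult)
  finally have "1 \<le> r * (1 - exp (- 1))"
    by simp
  then show False
    using r(2) by (simp add: exp_minus field_simps)
qed

lemma comp_ratio_ge_dyadic_bound:
  fixes n :: nat and \<delta> :: real
  assumes \<mu>: "\<mu> \<in> strategies" and \<delta>: "\<delta> < 1" "n * (1 - \<delta>) \<le> 1" and "0 < n"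
  shows "ereal (2 - 1 / 2 ^ (n - 1)) \<le> comp_ratio \<delta> \<mu>"
proof (cases "ereal 2 \<le> comp_ratio \<delta> \<mu>")
  case True
  have "ereal (2 - 1 / 2 ^ (n - 1)) \<le> ereal 2" by simp
  with True show ?thesis by (rule order_trans[rotated])
next
  case False
  interpret prob_space \<mu> using strategiesD(1)[OF \<mu>] .
  note [measurable_cong] = strategiesD(2)[OF \<mu>]
  have [simp]: "space \<mu> = UNIV" "sets \<mu> = sets borel"
    using strategiesD(2)[OF \<mu>] sets_eq_imp_space_eq[of \<mu> borel] by auto
  define a :: "nat \<Rightarrow> real" where "a k = 1 - 1 / 2 ^ k" for k
  have n\<delta>: "1 - \<delta> \<le> 1 / n"
    using \<delta> \<open>0 < n\<close> by (simp add: field_simps)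
  \<comment> \<open>The recursion \<open>a2\<close> with \<open>a 0 = 0\<close> is what determines
    the sequence: buying at \<open>a k\<close> just before the season ends at
    \<open>a (Suc k)\<close> costs twice the offline optimum.\<close>
  have a0: "0 < a (Suc k)" and a1: "a k \<le> 1" and a2: "a k + 1 = 2 * a (Suc k)"
    and a_mono: "a k \<le> a (Suc k)" for k
    by (auto simp: a_def field_simps one_less_power[of "2::real" "Suc k", simplified])
  have mass: "prob {..<a k} \<le> k / n" for k
  proof (induction k)
    case 0
    have "prob {..<0} = 0"
      using strategiesD(3)[OF \<mu>] by (subst prob_eq_0) (auto elim!: eventually_mono)
    then show ?case by (simp add: a_def)
  next
    case (Suc k)
    \<comment> \<open>At season length \<open>a (Suc k)\<close> every purchase in this interval
      costs at least \<open>a k + 1\<close>, so mass \<open>1 - \<delta>\<close> there would force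
      the ratio up to \<open>2\<close>.\<close>
    have "prob {a k..<a (Suc k)} < 1 - \<delta>"
    proof (rule ccontr)
      assume "\<not> ?thesis"
      then have "ereal (2 * min (a (Suc k)) 1) \<le> CVaR \<delta> \<mu> (\<lambda>x. ski_cost x (a (Suc k)))"
        using \<delta> a1[of "Suc k"] by (intro CVaR_ge_of_prob[where A = "{a k..<a (Suc k)}"])
          (auto simp: prob_space_axioms ski_cost_alt a2[symmetric])
      from comp_ratio_ge_of_CVaR[OF a0 this] show False using False by simp
    qed
    moreover have "prob {..<a (Suc k)} = prob {..<a k} + prob {a k..<a (Suc k)}"
      using a_mono[of k] by (subst finite_measure_Union[symmetric]) (auto simp: ivl_disj_un)
    ultimately show ?case using Suc n\<delta> by (simp add: add_divide_distrib)
  qed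
  have "prob {a (n - 1)..} = 1 - prob {..<a (n - 1)}"
    using prob_compl[of "{..<a (n - 1)}"] by (simp add: Compl_eq_Diff_UNIV[symmetric])
  also have "\<dots> \<ge> 1 / n"
    using mass[of "n - 1"] \<open>0 < n\<close> by (simp add: of_nat_diff diff_divide_distrib)
  \<comment> \<open>Season length \<open>2\<close> also covers late purchases: those after
    \<open>2\<close> cost \<open>2\<close>, which is at least \<open>a (n - 1) + 1\<close>, while
    the offline optimum is still \<open>1\<close>.\<close>
  finally have "ereal ((a (n - 1) + 1) * min 2 1) \<le> CVaR \<delta> \<mu> (\<lambda>x. ski_cost x 2)"
    using \<delta> n\<delta> a1[of "n - 1"]
    by (intro CVaR_ge_of_prob[where A = "{a (n - 1)..}"]) (auto simp: prob_space_axioms ski_cost_alt)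
  from comp_ratio_ge_of_CVaR[OF _ this] show ?thesis
    by (simp add: a_def)
qed

theorem theorem3:
  fixes \<delta> :: real
  assumes "0 \<le> \<delta>" and "\<delta> < 1"
  shows "opt_comp_ratio \<delta> \<ge>
    ereal (max (exp 1 / (exp 1 - 1)) (2 - 1 / 2 ^ nat (\<lfloor>1 / (1 - \<delta>)\<rfloor> - 1)))"
  unfolding opt_comp_ratio_def
proof (rule INF_greatest)
  fix \<mu> assume \<mu>: "\<mu> \<in> strategies"
  define n where "n = nat \<lfloor>1 / (1 - \<delta>)\<rfloor>"
  have "1 \<le> 1 / (1 - \<delta>)" using assms by simp
  then have "1 \<le> \<lfloor>1 / (1 - \<delta>)\<rfloor>" by linarith
  then have n: "0 < n" "nat (\<lfloor>1 / (1 - \<delta>)\<rfloor> - 1) = n - 1"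
    by (auto simp: n_def nat_diff_distrib)
  \<comment> \<open>The floor is the largest \<open>n\<close> with
    \<open>n * (1 - \<delta>) \<le> 1\<close>, hence the choice giving the strongest dyadic
    bound.\<close>
  have "real n \<le> 1 / (1 - \<delta>)"
    unfolding n_def using assms by (intro of_nat_floor) simp
  then have "n * (1 - \<delta>) \<le> 1"
    using assms by (simp add: field_simps)
  then have "ereal (2 - 1 / 2 ^ (n - 1)) \<le> comp_ratio \<delta> \<mu>"
    using \<mu> assms n by (intro comp_ratio_ge_dyadic_bound) auto
  then show "ereal (max (exp 1 / (exp 1 - 1)) (2 - 1 / 2 ^ nat (\<lfloor>1 / (1 - \<delta>)\<rfloor> - 1))) \<le> comp_ratio \<delta> \<mu>"
    using comp_ratio_ge_exp_bound[OF \<mu> assms] n(2) by (simp add: max_def)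
qed

end
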